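(* The category of specialization semilattices is isomorphic to the category of semilattices with a congruence. An isomorphism sends an object $(S,\vee,\sqsubseteq)$ to $(S,\vee,\Theta_{\sqsubseteq})$, where $a\mathrel{\Theta_{\sqsubseteq}}b$ iff both $a\sqsubseteq b$ and $b\sqsubseteq a$, and is the identity on morphisms (that is, it sends each morphism to the same underlying function).
   Context: A specialization semilattice is a triple $(S,\vee,\sqsubseteq)$ where $(S,\vee)$ is a join semilattice and $\sqsubseteq$ is a preorder (reflexive and transitive relation) on $S$ which is coarser than the order $\leq$ induced by $\vee$ (that is, $a\leq b$ implies $a\sqsubseteq b$) and such that, for all $a,a_1,b\in S$, $a\sqsubseteq b$ and $a_1\sqsubseteq b$ imply $a\vee a_1\sqsubseteq b$. Morphisms in the category of specialization semilattices are semilattice homomorphisms $\varphi$ such that $a\sqsubseteq b$ implies $\varphi(a)\sqsubseteq\varphi(b)$. A congruence on a join semilattice $(S,\vee)$ is an equivalence relation $\Theta$ on $S$ such that $a\mathrel{\Theta} b$ implies $a\vee c\mathrel{\Theta} b\vee c$ for all $a,b,c\in S$. The category of semilattices with a congruence has as objects the triples $(S,\vee,\Theta)$ with $(S,\vee)$ a join semilattice and $\Theta$ a congruence on it; a morphism from $(S,\vee_S,\Theta)$ to $(T,\vee_T,\Gamma)$ is a semilattice homomorphism $\varphi$ from $(S,\vee_S)$ to $(T,\vee_T)$ such that $a\mathrel{\Theta}b$ implies $\varphi(a)\mathrel{\Gamma}\varphi(b)$. *)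

theory Defs
  imports Main "HOL-Library.FuncSet"
begin

text \<open>
  Objects and arrows of a category are given as sets, so that equality of functors is equality
  on these sets only. \<open>Comp C g f\<close> is the composite ``\<open>g\<close> after \<open>f\<close>''; nothing is required of it
  unless \<open>Dom C g = Cod C f\<close>.
\<close>

record ('o, 'm) cat =
  Obj :: "'o set"
  Arr :: "'m set"
  Dom :: "'m \<Rightarrow> 'o"
  Cod :: "'m \<Rightarrow> 'o"
  Ident :: "'o \<Rightarrow> 'm"
  Comp :: "'m \<Rightarrow> 'm \<Rightarrow> 'm"

locale category =
  fixes C :: "('o, 'm) cat"
  assumes Dom_in_Obj: "f \<in> Arr C \<Longrightarrow> Dom C f \<in> Obj C"
    and Cod_in_Obj: "f \<in> Arr C \<Longrightarrow> Cod C f \<in> Obj C"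
    and Ident_in_Arr: "A \<in> Obj C \<Longrightarrow> Ident C A \<in> Arr C"
    and Dom_Ident: "A \<in> Obj C \<Longrightarrow> Dom C (Ident C A) = A"
    and Cod_Ident: "A \<in> Obj C \<Longrightarrow> Cod C (Ident C A) = A"
    and Comp_in_Arr:
      "\<lbrakk>f \<in> Arr C; g \<in> Arr C; Dom C g = Cod C f\<rbrakk> \<Longrightarrow> Comp C g f \<in> Arr C"
    and Dom_Comp:
      "\<lbrakk>f \<in> Arr C; g \<in> Arr C; Dom C g = Cod C f\<rbrakk> \<Longrightarrow> Dom C (Comp C g f) = Dom C f"
    and Cod_Comp:
      "\<lbrakk>f \<in> Arr C; g \<in> Arr C; Dom C g = Cod C f\<rbrakk> \<Longrightarrow> Cod C (Comp C g f) = Cod C g"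
    and Comp_Ident_right: "f \<in> Arr C \<Longrightarrow> Comp C f (Ident C (Dom C f)) = f"
    and Comp_Ident_left: "f \<in> Arr C \<Longrightarrow> Comp C (Ident C (Cod C f)) f = f"
    and Comp_assoc:
      "\<lbrakk>f \<in> Arr C; g \<in> Arr C; h \<in> Arr C; Dom C g = Cod C f; Dom C h = Cod C g\<rbrakk>
        \<Longrightarrow> Comp C h (Comp C g f) = Comp C (Comp C h g) f"

locale cat_functor = source: category C + target: category D
  for C :: "('o, 'm) cat" and D :: "('p, 'n) cat" +
  fixes F_obj :: "'o \<Rightarrow> 'p" and F_arr :: "'m \<Rightarrow> 'n"
  assumes F_obj_in_Obj: "A \<in> Obj C \<Longrightarrow> F_obj A \<in> Obj D"
    and F_arr_in_Arr: "f \<in> Arr C \<Longrightarrow> F_arr f \<in> Arr D"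
    and Dom_F_arr: "f \<in> Arr C \<Longrightarrow> Dom D (F_arr f) = F_obj (Dom C f)"
    and Cod_F_arr: "f \<in> Arr C \<Longrightarrow> Cod D (F_arr f) = F_obj (Cod C f)"
    and F_arr_Ident: "A \<in> Obj C \<Longrightarrow> F_arr (Ident C A) = Ident D (F_obj A)"
    and F_arr_Comp:
      "\<lbrakk>f \<in> Arr C; g \<in> Arr C; Dom C g = Cod C f\<rbrakk>
        \<Longrightarrow> F_arr (Comp C g f) = Comp D (F_arr g) (F_arr f)"

definition cat_isomorphism ::
  "('o, 'm) cat \<Rightarrow> ('p, 'n) cat \<Rightarrow> ('o \<Rightarrow> 'p) \<Rightarrow> ('m \<Rightarrow> 'n) \<Rightarrow> bool"
  where "cat_isomorphism C D F_obj F_arr \<longleftrightarrow>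
    cat_functor C D F_obj F_arr \<and>
    (\<exists>G_obj G_arr. cat_functor D C G_obj G_arr \<and>
      (\<forall>A\<in>Obj C. G_obj (F_obj A) = A) \<and> (\<forall>f\<in>Arr C. G_arr (F_arr f) = f) \<and>
      (\<forall>B\<in>Obj D. F_obj (G_obj B) = B) \<and> (\<forall>g\<in>Arr D. F_arr (G_arr g) = g))"

definition isomorphic_cats :: "('o, 'm) cat \<Rightarrow> ('p, 'n) cat \<Rightarrow> bool"
  where "isomorphic_cats C D \<longleftrightarrow> (\<exists>F_obj F_arr. cat_isomorphism C D F_obj F_arr)"

text \<open>
  Carriers are arbitrary subsets of a type \<open>'a\<close>, which plays the role of the universe.
  The values of \<open>join\<close> outside the carrier are fixed to \<open>undefined\<close>, so that two structures
  with the same carrier and the same operation on it are equal records.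
\<close>

record 'a semilat =
  carrier :: "'a set"
  join :: "'a \<Rightarrow> 'a \<Rightarrow> 'a"

locale join_semilattice =
  fixes S :: "('a, 'b) semilat_scheme"
  assumes join_closed: "\<lbrakk>a \<in> carrier S; b \<in> carrier S\<rbrakk> \<Longrightarrow> join S a b \<in> carrier S"
    and join_undefined: "\<not> (a \<in> carrier S \<and> b \<in> carrier S) \<Longrightarrow> join S a b = undefined"
    and join_assoc:
      "\<lbrakk>a \<in> carrier S; b \<in> carrier S; c \<in> carrier S\<rbrakk>
        \<Longrightarrow> join S (join S a b) c = join S a (join S b c)"
    and join_commute: "\<lbrakk>a \<in> carrier S; b \<in> carrier S\<rbrakk> \<Longrightarrow> join S a b = join S b a"
    and join_idem: "a \<in> carrier S \<Longrightarrow> join S a a = a"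

definition semilat_le :: "('a, 'b) semilat_scheme \<Rightarrow> 'a \<Rightarrow> 'a \<Rightarrow> bool"
  where "semilat_le S a b \<longleftrightarrow> a \<in> carrier S \<and> b \<in> carrier S \<and> join S a b = b"

definition semilat_hom ::
  "('a, 'b) semilat_scheme \<Rightarrow> ('a, 'b) semilat_scheme \<Rightarrow> ('a \<Rightarrow> 'a) set"
  where "semilat_hom S T = {f \<in> carrier S \<rightarrow>\<^sub>E carrier T.
    \<forall>a\<in>carrier S. \<forall>b\<in>carrier S. f (join S a b) = join T (f a) (f b)}"

record 'a spec_semilat = "'a semilat" +
  spec :: "('a \<times> 'a) set"

locale specialization_semilattice = join_semilattice S
  for S :: "'a spec_semilat" +
  assumes spec_preorder: "preorder_on (carrier S) (spec S)"
    and le_imp_spec: "semilat_le S a b \<Longrightarrow> (a, b) \<in> spec S"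
    and join_spec: "\<lbrakk>(a, b) \<in> spec S; (a1, b) \<in> spec S\<rbrakk> \<Longrightarrow> (join S a a1, b) \<in> spec S"

definition spec_hom :: "'a spec_semilat \<Rightarrow> 'a spec_semilat \<Rightarrow> ('a \<Rightarrow> 'a) set"
  where "spec_hom S T =
    {f \<in> semilat_hom S T. \<forall>a b. (a, b) \<in> spec S \<longrightarrow> (f a, f b) \<in> spec T}"

record 'a cong_semilat = "'a semilat" +
  cong :: "('a \<times> 'a) set"

locale semilattice_with_congruence = join_semilattice S
  for S :: "'a cong_semilat" +
  assumes cong_equiv: "equiv (carrier S) (cong S)"
    and cong_join:
      "\<lbrakk>(a, b) \<in> cong S; c \<in> carrier S\<rbrakk> \<Longrightarrow> (join S a c, join S b c) \<in> cong S"

definition cong_hom :: "'a cong_semilat \<Rightarrow> 'a cong_semilat \<Rightarrow> ('a \<Rightarrow> 'a) set"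
  where "cong_hom S T =
    {f \<in> semilat_hom S T. \<forall>a b. (a, b) \<in> cong S \<longrightarrow> (f a, f b) \<in> cong T}"

text \<open>
  An arrow records its source and target, so each arrow has unique domain and codomain.
  Its function is extensional on the source's carrier, so that arrows are determined by their
  values there.
\<close>

record ('o, 'a) arrow =
  src :: 'o
  fn :: "'a \<Rightarrow> 'a"
  trg :: 'o

definition concrete_cat ::
  "'o set \<Rightarrow> ('o \<Rightarrow> 'a set) \<Rightarrow> ('o \<Rightarrow> 'o \<Rightarrow> ('a \<Rightarrow> 'a) set) \<Rightarrow> ('o, ('o, 'a) arrow) cat"
  where "concrete_cat objs U hom = \<lparr>
    Obj = objs,
    Arr = {f. src f \<in> objs \<and> trg f \<in> objs \<and> fn f \<in> hom (src f) (trg f)},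
    Dom = src,
    Cod = trg,
    Ident = (\<lambda>A. \<lparr>src = A, fn = (\<lambda>x\<in>U A. x), trg = A\<rparr>),
    Comp = (\<lambda>g f. \<lparr>src = src f, fn = compose (U (src f)) (fn g) (fn f), trg = trg g\<rparr>)\<rparr>"

definition spec_cat :: "('a spec_semilat, ('a spec_semilat, 'a) arrow) cat"
  where "spec_cat = concrete_cat {S. specialization_semilattice S} carrier spec_hom"

definition cong_cat :: "('a cong_semilat, ('a cong_semilat, 'a) arrow) cat"
  where "cong_cat = concrete_cat {S. semilattice_with_congruence S} carrier cong_hom"

definition Theta :: "'a spec_semilat \<Rightarrow> ('a \<times> 'a) set"
  where "Theta S = {(a, b). (a, b) \<in> spec S \<and> (b, a) \<in> spec S}"

definition Theta_obj :: "'a spec_semilat \<Rightarrow> 'a cong_semilat"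
  where "Theta_obj S = \<lparr>carrier = carrier S, join = join S, cong = Theta S\<rparr>"

definition Theta_arr :: "('a spec_semilat, 'a) arrow \<Rightarrow> ('a cong_semilat, 'a) arrow"
  where "Theta_arr f = \<lparr>src = Theta_obj (src f), fn = fn f, trg = Theta_obj (trg f)\<rparr>"

end

theory Submission
  imports Defs
begin

text \<open>
  On a fixed join semilattice, specialization relations and congruences determine each other.
  For fixed \<open>b\<close>, the elements \<open>x\<close> with \<open>x \<sqsubseteq> b\<close> are closed under joins and downwards for the
  semilattice order, and \<open>b\<close> is one of them; so \<open>a \<sqsubseteq> b\<close> holds exactly when \<open>a \<squnion> b \<sqsubseteq> b\<close>,
  and \<open>b \<sqsubseteq> a \<squnion> b\<close> is automatic (\<open>spec_iff_Theta_join\<close>).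
  Hence \<open>\<sqsubseteq>\<close> can be recovered from its symmetric part, a congruence \<open>\<Theta>\<close>, by the rule that
  \<open>a \<sqsubseteq> b\<close> iff \<open>(a \<squnion> b) \<Theta> b\<close>. Read as a definition, the same rule turns any
  congruence into a specialization relation (\<open>spec_of_cong_semilattice\<close>), whose symmetric part
  is the congruence one started from (\<open>Theta_spec_of_cong\<close>). That is the bijection on objects.

  On arrows, both structures lie over the same semilattice, and each relation is defined from the
  other and \<open>\<squnion>\<close> by a formula that semilattice homomorphisms preserve; so a homomorphism
  respects the specializations iff it respects the congruences
  (\<open>cong_hom_Theta_obj\<close>). An object bijection that preserves the underlying sets and under which
  the sets of homomorphisms agree is an isomorphism of concrete categories
  (\<open>concrete_cat_isomorphism\<close>).
\<close>

section \<open>Categories of sets with structure\<close>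

locale concrete_homs =
  fixes objs :: "'o set" and U :: "'o \<Rightarrow> 'a set" and hom :: "'o \<Rightarrow> 'o \<Rightarrow> ('a \<Rightarrow> 'a) set"
  assumes hom_extensional_funcset: "hom A B \<subseteq> U A \<rightarrow>\<^sub>E U B"
    and hom_id: "A \<in> objs \<Longrightarrow> (\<lambda>x\<in>U A. x) \<in> hom A A"
    and hom_compose: "\<lbrakk>A \<in> objs; f \<in> hom A B; g \<in> hom B C\<rbrakk> \<Longrightarrow> compose (U A) g f \<in> hom A C"
begin

text \<open>
  Homomorphisms are \<open>undefined\<close> off the carrier of their source, so the unit laws hold as
  equations between total functions.
\<close>

lemma category_concrete_cat: "category (concrete_cat objs U hom)"
proof -
  have id_right: "compose (U A) f (\<lambda>x\<in>U A. x) = f"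
    and id_left: "compose (U A) (\<lambda>x\<in>U B. x) f = f" if "f \<in> hom A B" for A B f
    using subsetD[OF hom_extensional_funcset that] by (auto simp: PiE_def compose_Id Id_compose)
  have assoc: "compose (U A) h (compose (U A) g f) = compose (U A) (compose (U B) h g) f"
    if "f \<in> hom A B" for A B f g h
    using that hom_extensional_funcset[of A B] by (auto intro!: compose_assoc)
  show ?thesis
    by unfold_locales
      (auto simp: concrete_cat_def hom_id id_right id_left assoc intro: hom_compose)
qed

end

definition map_arrow :: "('o \<Rightarrow> 'p) \<Rightarrow> ('o, 'a) arrow \<Rightarrow> ('p, 'a) arrow"
  where "map_arrow F f = \<lparr>src = F (src f), fn = fn f, trg = F (trg f)\<rparr>"

lemma concrete_cat_functor:
  assumes "concrete_homs objs U hom" and "concrete_homs objs' U' hom'"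
    and F_in: "\<And>A. A \<in> objs \<Longrightarrow> F A \<in> objs'"
    and U_F: "\<And>A. A \<in> objs \<Longrightarrow> U' (F A) = U A"
    and hom_F: "\<And>A B. \<lbrakk>A \<in> objs; B \<in> objs\<rbrakk> \<Longrightarrow> hom A B \<subseteq> hom' (F A) (F B)"
  shows "cat_functor (concrete_cat objs U hom) (concrete_cat objs' U' hom') F (map_arrow F)"
proof -
  interpret source: category "concrete_cat objs U hom"
    using assms(1) by (rule concrete_homs.category_concrete_cat)
  interpret target: category "concrete_cat objs' U' hom'"
    using assms(2) by (rule concrete_homs.category_concrete_cat)
  show ?thesis
    by unfold_locales
      (use hom_F in \<open>auto simp: concrete_cat_def map_arrow_def F_in U_F\<close>)
qed

lemma concrete_cat_isomorphism:
  assumes "concrete_homs objs U hom" and "concrete_homs objs' U' hom'"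
    and F_in: "\<And>A. A \<in> objs \<Longrightarrow> F A \<in> objs'" and G_in: "\<And>B. B \<in> objs' \<Longrightarrow> G B \<in> objs"
    and G_F: "\<And>A. A \<in> objs \<Longrightarrow> G (F A) = A" and F_G: "\<And>B. B \<in> objs' \<Longrightarrow> F (G B) = B"
    and U_F: "\<And>A. A \<in> objs \<Longrightarrow> U' (F A) = U A"
    and hom_F: "\<And>A B. \<lbrakk>A \<in> objs; B \<in> objs\<rbrakk> \<Longrightarrow> hom' (F A) (F B) = hom A B"
  shows "cat_isomorphism (concrete_cat objs U hom) (concrete_cat objs' U' hom') F (map_arrow F)"
proof -
  have "cat_functor (concrete_cat objs U hom) (concrete_cat objs' U' hom') F (map_arrow F)"
    using assms by (intro concrete_cat_functor) auto
  moreover have "cat_functor (concrete_cat objs' U' hom') (concrete_cat objs U hom) G (map_arrow G)"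
  proof (rule concrete_cat_functor)
    fix A B assume "A \<in> objs'" "B \<in> objs'"
    then show "hom' A B \<subseteq> hom (G A) (G B)"
      using hom_F[of "G A" "G B"] by (simp add: G_in F_G)
  next
    fix B assume "B \<in> objs'"
    then show "U (G B) = U' B"
      using U_F[of "G B"] by (simp add: G_in F_G)
  qed (use assms in auto)
  ultimately show ?thesis
    unfolding cat_isomorphism_def
    by (intro conjI exI[of _ G] exI[of _ "map_arrow G"])
      (auto simp: concrete_cat_def map_arrow_def G_F F_G)
qed

section \<open>Homomorphisms of semilattices with a relation\<close>

lemma semilat_hom_closed:
  "\<lbrakk>f \<in> semilat_hom S T; a \<in> carrier S\<rbrakk> \<Longrightarrow> f a \<in> carrier T"
  by (auto simp: semilat_hom_def)

lemma semilat_hom_join: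
  "\<lbrakk>f \<in> semilat_hom S T; a \<in> carrier S; b \<in> carrier S\<rbrakk>
    \<Longrightarrow> f (join S a b) = join T (f a) (f b)"
  by (auto simp: semilat_hom_def)

lemma (in join_semilattice) semilat_hom_id: "(\<lambda>x\<in>carrier S. x) \<in> semilat_hom S S"
  by (auto simp: semilat_hom_def join_closed)

text \<open>
  The source has to be a semilattice: a join that left its carrier would be sent to \<open>undefined\<close> by
  \<open>compose\<close>, whatever the value of \<open>g\<close> after \<open>f\<close> there.
\<close>

lemma (in join_semilattice) semilat_hom_compose:
  assumes "f \<in> semilat_hom S T" and "g \<in> semilat_hom T V"
  shows "compose (carrier S) g f \<in> semilat_hom S V"
  using assms by (auto simp: semilat_hom_def compose_def PiE_iff join_closed)

section \<open>From specializations to congruences\<close>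

context specialization_semilattice
begin

lemma spec_in_carrier: "(a, b) \<in> spec S \<Longrightarrow> a \<in> carrier S \<and> b \<in> carrier S"
  using spec_preorder by (auto simp: preorder_on_def)

lemma spec_refl: "a \<in> carrier S \<Longrightarrow> (a, a) \<in> spec S"
  using spec_preorder by (auto simp: preorder_on_def refl_on_def)

lemma spec_trans: "\<lbrakk>(a, b) \<in> spec S; (b, c) \<in> spec S\<rbrakk> \<Longrightarrow> (a, c) \<in> spec S"
  using spec_preorder by (auto simp: preorder_on_def dest: transD)

lemma spec_join_left:
  assumes "a \<in> carrier S" and "b \<in> carrier S"
  shows "(a, join S a b) \<in> spec S"
proof (rule le_imp_spec)
  have "join S a (join S a b) = join S a b"
    using assms join_assoc[of a a b] by (simp add: join_idem)
  then show "semilat_le S a (join S a b)"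
    using assms by (simp add: semilat_le_def join_closed)
qed

lemma spec_join_right:
  assumes "a \<in> carrier S" and "b \<in> carrier S"
  shows "(b, join S a b) \<in> spec S"
  using spec_join_left[OF assms(2,1)] join_commute[OF assms] by simp

lemma join_spec_mono:
  assumes "(a, b) \<in> spec S" and "c \<in> carrier S"
  shows "(join S a c, join S b c) \<in> spec S"
  using assms spec_in_carrier[OF assms(1)]
  by (meson join_spec spec_join_left spec_join_right spec_trans)

text \<open>
  If \<open>a \<sqsubseteq> b\<close> then, as also \<open>b \<sqsubseteq> b\<close>, the join of \<open>a\<close> and \<open>b\<close> specializes \<open>b\<close>, too; conversely \<open>a \<le> a \<squnion> b \<sqsubseteq> b\<close>.
\<close>

lemma spec_iff_Theta_join:
  assumes "a \<in> carrier S" and "b \<in> carrier S"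
  shows "(a, b) \<in> spec S \<longleftrightarrow> (join S a b, b) \<in> Theta S"
  using assms unfolding Theta_def
  by (auto intro: join_spec spec_refl spec_join_right spec_trans[OF spec_join_left])

text \<open>
  Compatibility of \<open>\<Theta>\<close> with joins is monotonicity of joins for \<open>\<sqsubseteq>\<close>, applied in both directions.
\<close>

lemma Theta_obj_semilattice_with_congruence: "semilattice_with_congruence (Theta_obj S)"
proof -
  have "equiv (carrier S) (Theta S)"
    by (intro equivI refl_onI symI transI)
      (auto simp: Theta_def dest: spec_in_carrier intro: spec_refl spec_trans)
  then show ?thesis
    by unfold_locales
      (auto simp: Theta_obj_def join_closed join_undefined join_assoc join_idem Theta_def
        intro: join_commute join_spec_mono)
qed

end

section \<open>From congruences to specializations\<close>

definition spec_of_cong :: "'a cong_semilat \<Rightarrow> 'a spec_semilat"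
  where "spec_of_cong S = \<lparr>carrier = carrier S, join = join S,
    spec = {(a, b). a \<in> carrier S \<and> b \<in> carrier S \<and> (join S a b, b) \<in> cong S}\<rparr>"

context semilattice_with_congruence
begin

lemma cong_in_carrier: "(a, b) \<in> cong S \<Longrightarrow> a \<in> carrier S \<and> b \<in> carrier S"
  using cong_equiv by (auto simp: equiv_def)

lemma cong_refl: "a \<in> carrier S \<Longrightarrow> (a, a) \<in> cong S"
  using cong_equiv by (auto simp: equiv_def refl_on_def)

lemma cong_sym: "(a, b) \<in> cong S \<Longrightarrow> (b, a) \<in> cong S"
  using cong_equiv by (auto simp: equiv_def dest: symD)

lemma cong_trans: "\<lbrakk>(a, b) \<in> cong S; (b, c) \<in> cong S\<rbrakk> \<Longrightarrow> (a, c) \<in> cong S"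
  using cong_equiv by (auto simp: equiv_def dest: transD)

lemma cong_join_left:
  assumes "(a, b) \<in> cong S" and "c \<in> carrier S"
  shows "(join S c a, join S c b) \<in> cong S"
  using cong_join[OF assms] cong_in_carrier[OF assms(1)] assms(2)
  by (simp add: join_commute[of c])

text \<open>
  Writing \<open>a \<sqsubseteq> b\<close> for \<open>(a \<squnion> b) \<Theta> b\<close>, transitivity is the chain
  \<open>a \<squnion> c \<Theta> a \<squnion> (b \<squnion> c) = (a \<squnion> b) \<squnion> c \<Theta> b \<squnion> c \<Theta> c\<close>, and closure under joins is
  \<open>(a \<squnion> a\<^sub>1) \<squnion> b = a \<squnion> (a\<^sub>1 \<squnion> b) \<Theta> a \<squnion> b \<Theta> b\<close>. The relation extends the order because
  \<open>\<Theta>\<close> is reflexive.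
\<close>

lemma spec_of_cong_semilattice: "specialization_semilattice (spec_of_cong S)"
proof -
  have trans: "(join S a c, c) \<in> cong S"
    if carr: "a \<in> carrier S" "b \<in> carrier S" "c \<in> carrier S"
      and ab: "(join S a b, b) \<in> cong S" and bc: "(join S b c, c) \<in> cong S" for a b c
  proof -
    have "(join S a c, join S a (join S b c)) \<in> cong S"
      using cong_sym[OF bc] carr(1) by (rule cong_join_left)
    moreover have "(join S a (join S b c), join S b c) \<in> cong S"
      using cong_join[OF ab carr(3)] by (simp add: join_assoc carr)
    ultimately show ?thesis
      using bc by (blast intro: cong_trans)
  qed
  have join: "(join S a (join S a1 b), b) \<in> cong S"
    if carr: "a \<in> carrier S" "a1 \<in> carrier S" "b \<in> carrier S"
      and ab: "(join S a b, b) \<in> cong S" and a1b: "(join S a1 b, b) \<in> cong S" for a a1 b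
    using cong_join_left[OF a1b carr(1)] ab by (rule cong_trans)
  have "preorder_on (carrier S) (spec (spec_of_cong S))"
    unfolding preorder_on_def
    by (auto simp: spec_of_cong_def join_idem cong_refl intro!: refl_onI transI
        intro: trans)
  then show ?thesis
    by unfold_locales
      (auto simp: spec_of_cong_def semilat_le_def join_closed join_undefined join_assoc
        join_idem cong_refl join intro: join_commute)
qed

text \<open>
  If \<open>(a \<squnion> b) \<Theta> b\<close> and \<open>(b \<squnion> a) \<Theta> a\<close> then \<open>a\<close> and \<open>b\<close> are both congruent to their join;
  conversely, joining \<open>a \<Theta> b\<close> with \<open>b\<close> gives \<open>(a \<squnion> b) \<Theta> b\<close> by idempotence.
\<close>

lemma Theta_spec_of_cong: "Theta (spec_of_cong S) = cong S"
proof -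
  have "(a, b) \<in> cong S"
    if "a \<in> carrier S" "b \<in> carrier S"
      and "(join S a b, b) \<in> cong S" "(join S b a, a) \<in> cong S" for a b
    using that join_commute[of a b] by (metis cong_sym cong_trans)
  moreover have "(join S a b, b) \<in> cong S" if "(a, b) \<in> cong S" for a b
    using cong_join[OF that, of b] cong_in_carrier[OF that] by (simp add: join_idem)
  ultimately show ?thesis
    by (auto simp: Theta_def spec_of_cong_def dest: cong_in_carrier cong_sym)
qed

lemma Theta_obj_spec_of_cong: "Theta_obj (spec_of_cong S) = S"
proof -
  have "Theta_obj (spec_of_cong S) = \<lparr>carrier = carrier S, join = join S, cong = cong S\<rparr>"
    unfolding Theta_obj_def Theta_spec_of_cong by (simp add: spec_of_cong_def)
  then show ?thesis
    by simp
qed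

end

lemma (in specialization_semilattice) spec_of_cong_Theta_obj: "spec_of_cong (Theta_obj S) = S"
proof -
  have "spec S = {(a, b). a \<in> carrier S \<and> b \<in> carrier S \<and> (join S a b, b) \<in> Theta S}"
    using spec_in_carrier spec_iff_Theta_join by blast
  then show ?thesis
    by (simp add: spec_of_cong_def Theta_obj_def)
qed

section \<open>The isomorphism of categories\<close>

text \<open>
  The relation \<open>\<Theta>\<close> is the symmetric part of \<open>\<sqsubseteq>\<close>, so preserving \<open>\<sqsubseteq>\<close> preserves \<open>\<Theta>\<close>. In the other
  direction \<open>a \<sqsubseteq> b\<close> means \<open>(a \<squnion> b) \<Theta> b\<close>, and a homomorphism \<open>f\<close> preserving \<open>\<Theta>\<close> takes this
  to \<open>(f a \<squnion> f b) \<Theta> f b\<close>.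
\<close>

lemma cong_hom_Theta_obj:
  assumes "specialization_semilattice S" and "specialization_semilattice T"
  shows "cong_hom (Theta_obj S) (Theta_obj T) = spec_hom S T"
proof -
  interpret S: specialization_semilattice S by fact
  interpret T: specialization_semilattice T by fact
  have semilat_hom_Theta_obj: "semilat_hom (Theta_obj S) (Theta_obj T) = semilat_hom S T"
    by (simp add: semilat_hom_def Theta_obj_def)
  have "(f a, f b) \<in> spec T"
    if f: "f \<in> semilat_hom S T" and ab: "(a, b) \<in> spec S"
      and pres: "\<forall>a b. (a, b) \<in> Theta S \<longrightarrow> (f a, f b) \<in> Theta T" for f a b
  proof -
    have carr: "a \<in> carrier S" "b \<in> carrier S"
      using S.spec_in_carrier[OF ab] by auto
    then have "(f (join S a b), f b) \<in> Theta T"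
      using ab pres by (simp add: S.spec_iff_Theta_join)
    then show ?thesis
      using f carr by (simp add: T.spec_iff_Theta_join semilat_hom_closed semilat_hom_join)
  qed
  then have "cong_hom (Theta_obj S) (Theta_obj T) \<subseteq> spec_hom S T"
    unfolding cong_hom_def spec_hom_def semilat_hom_Theta_obj by (simp add: Theta_obj_def) blast
  moreover have "spec_hom S T \<subseteq> cong_hom (Theta_obj S) (Theta_obj T)"
    unfolding cong_hom_def spec_hom_def semilat_hom_Theta_obj
    by (auto simp: Theta_obj_def Theta_def)
  ultimately show ?thesis
    by (rule subset_antisym)
qed

lemma concrete_homs_spec:
  "concrete_homs {S :: 'a spec_semilat. specialization_semilattice S} carrier spec_hom"
proof unfold_locales
  show "spec_hom A B \<subseteq> carrier A \<rightarrow>\<^sub>E carrier B" for A B :: "'a spec_semilat"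
    by (auto simp: spec_hom_def semilat_hom_def)
next
  fix A :: "'a spec_semilat" assume "A \<in> {S. specialization_semilattice S}"
  then interpret specialization_semilattice A by simp
  show "(\<lambda>x\<in>carrier A. x) \<in> spec_hom A A"
    using semilat_hom_id by (auto simp: spec_hom_def dest: spec_in_carrier)
  show "compose (carrier A) g f \<in> spec_hom A C"
    if "f \<in> spec_hom A B" "g \<in> spec_hom B C" for B C f g
    using that semilat_hom_compose[of f B g C]
    by (auto simp: spec_hom_def compose_def dest: spec_in_carrier)
qed

lemma concrete_homs_cong:
  "concrete_homs {S :: 'a cong_semilat. semilattice_with_congruence S} carrier cong_hom"
proof unfold_locales
  show "cong_hom A B \<subseteq> carrier A \<rightarrow>\<^sub>E carrier B" for A B :: "'a cong_semilat"
    by (auto simp: cong_hom_def semilat_hom_def)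
next
  fix A :: "'a cong_semilat" assume "A \<in> {S. semilattice_with_congruence S}"
  then interpret semilattice_with_congruence A by simp
  show "(\<lambda>x\<in>carrier A. x) \<in> cong_hom A A"
    using semilat_hom_id by (auto simp: cong_hom_def dest: cong_in_carrier)
  show "compose (carrier A) g f \<in> cong_hom A C"
    if "f \<in> cong_hom A B" "g \<in> cong_hom B C" for B C f g
    using that semilat_hom_compose[of f B g C]
    by (auto simp: cong_hom_def compose_def dest: cong_in_carrier)
qed

lemma Theta_obj_carrier: "carrier (Theta_obj S) = carrier S"
  by (simp add: Theta_obj_def)

lemma Theta_arr_eq_map_arrow: "Theta_arr = map_arrow Theta_obj"
  by (simp add: fun_eq_iff Theta_arr_def map_arrow_def)

theorem corollary2p5:
  shows "isomorphic_cats
      (spec_cat :: ('a spec_semilat, ('a spec_semilat, 'a) arrow) cat)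
      (cong_cat :: ('a cong_semilat, ('a cong_semilat, 'a) arrow) cat) \<and>
    cat_isomorphism
      (spec_cat :: ('a spec_semilat, ('a spec_semilat, 'a) arrow) cat)
      (cong_cat :: ('a cong_semilat, ('a cong_semilat, 'a) arrow) cat)
      Theta_obj Theta_arr"
proof -
  have "cat_isomorphism
      (spec_cat :: ('a spec_semilat, ('a spec_semilat, 'a) arrow) cat)
      (cong_cat :: ('a cong_semilat, ('a cong_semilat, 'a) arrow) cat)
      Theta_obj Theta_arr"
    unfolding spec_cat_def cong_cat_def Theta_arr_eq_map_arrow
    by (rule concrete_cat_isomorphism[where G = spec_of_cong,
          OF concrete_homs_spec concrete_homs_cong])
      (simp_all add: cong_hom_Theta_obj Theta_obj_carrier
        specialization_semilattice.Theta_obj_semilattice_with_congruence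
        semilattice_with_congruence.spec_of_cong_semilattice
        specialization_semilattice.spec_of_cong_Theta_obj
        semilattice_with_congruence.Theta_obj_spec_of_cong)
  then show ?thesis
    unfolding isomorphic_cats_def by blast
qed

end
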